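(* Let $\Lambda=(\mathcal{L},\mathfrak{M},\models)$ be a reception-compatible satisfaction system and let $\oplus:\mathcal{P}_{\mathrm{fin}}(\mathcal{L})\times\mathcal{P}(\mathfrak{M})\to\mathcal{P}_{\mathrm{fin}}(\mathcal{L})$ be a model change operation. Then there exists a selection function $\gamma$ on $\Lambda$ such that $\mathrm{Mod}(\oplus(B,\mathbb{M}))=\gamma(\mathrm{FRsups}(\mathrm{Mod}(B)\cup\mathbb{M},\Lambda))$ for all $B\in\mathcal{P}_{\mathrm{fin}}(\mathcal{L})$ and $\mathbb{M}\subseteq\mathfrak{M}$ (i.e. $\oplus$ is a maxichoice reception function) if and only if $\oplus$ satisfies, for all $B,B'\in\mathcal{P}_{\mathrm{fin}}(\mathcal{L})$ and $\mathbb{M},\mathbb{M}'\subseteq\mathfrak{M}$: (success) $\mathbb{M}\subseteq\mathrm{Mod}(\oplus(B,\mathbb{M}))$; (persistence) $\mathrm{Mod}(B)\subseteq\mathrm{Mod}(\oplus(B,\mathbb{M}))$; (vacuity) if $\mathbb{M}\subseteq\mathrm{Mod}(B)$ then $\mathrm{Mod}(\oplus(B,\mathbb{M}))=\mathrm{Mod}(B)$; (finite temperance) if $\mathrm{Mod}(B)\cup\mathbb{M}\subseteq\mathbb{M}''\subsetneq\mathrm{Mod}(\oplus(B,\mathbb{M}))$ then $\mathbb{M}''\notin\mathrm{FR}(\Lambda)$; (uniformity) if $\mathrm{FRsups}(\mathrm{Mod}(B)\cup\mathbb{M},\Lambda)=\mathrm{FRsups}(\mathrm{Mod}(B')\cup\mathbb{M}',\Lambda)$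 then $\mathrm{Mod}(\oplus(B,\mathbb{M}))=\mathrm{Mod}(\oplus(B',\mathbb{M}'))$.
   Context: A satisfaction system is a triple $\Lambda=(\mathcal{L},\mathfrak{M},\models)$ where $\mathcal{L}$ is a set of formulae, $\mathfrak{M}$ a set of models, and $\models$ a relation between models and sets of formulae $B\subseteq\mathcal{L}$. $\mathrm{Mod}(B)=\{m\in\mathfrak{M}\mid m\models B\}$. $\mathcal{P}(A)$ is the power set of $A$, $\mathcal{P}_{\mathrm{fin}}(A)$ the set of finite subsets of $A$. $\mathrm{FR}(\Lambda)=\{X\subseteq\mathfrak{M}\mid X=\mathrm{Mod}(B)$ for some $B\in\mathcal{P}_{\mathrm{fin}}(\mathcal{L})\}$. For $\mathbb{M}\subseteq\mathfrak{M}$, $\mathrm{FRsups}(\mathbb{M},\Lambda)=\{X\in\mathrm{FR}(\Lambda)\mid \mathbb{M}\subseteq X$ and there is no $Y\in\mathrm{FR}(\Lambda)$ with $\mathbb{M}\subseteq Y\subsetneq X\}$. $\Lambda$ is reception-compatible if $\mathrm{FRsups}(\mathrm{Mod}(B)\cup\mathbb{M},\Lambda)\neq\emptyset$ for all $B\in\mathcal{P}_{\mathrm{fin}}(\mathcal{L})$ and $\mathbb{M}\subseteq\mathfrak{M}$. A model change operation is any function $\mathcal{P}_{\mathrm{fin}}(\mathcal{L})\times\mathcal{P}(\mathfrak{M})\to\mathcal{P}_{\mathrm{fin}}(\mathcal{L})$. A selection function on $\Lambda$ is a map $\gamma$ from the nonempty subsets of $\mathrm{FR}(\Lambda)$ to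 $\mathrm{FR}(\Lambda)$ with $\gamma(X)\in X$ for every nonempty $X\subseteq\mathrm{FR}(\Lambda)$. *)

theory Defs
  imports Main "HOL-Library.FuncSet"
begin

text \<open>
  Formulae and models are carrier sets rather than whole types, so that either may be empty.
  Satisfaction relates a model to a set of formulae and need not be determined by single formulae;
  its values outside the carriers are irrelevant.
\<close>

record ('f, 'm) satisfaction_system =
  formulae :: "'f set"
  models :: "'m set"
  sat :: "'m \<Rightarrow> 'f set \<Rightarrow> bool"

definition Mod :: "('f, 'm) satisfaction_system \<Rightarrow> 'f set \<Rightarrow> 'm set" where
  "Mod \<Lambda> B = {m \<in> models \<Lambda>. sat \<Lambda> m B}"

definition FR :: "('f, 'm) satisfaction_system \<Rightarrow> 'm set set" where
  "FR \<Lambda> = {X. X \<subseteq> models \<Lambda> \<and> (\<exists>B \<in> Fpow (formulae \<Lambda>). X = Mod \<Lambda> B)}"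

definition FRsups :: "'m set \<Rightarrow> ('f, 'm) satisfaction_system \<Rightarrow> 'm set set" where
  "FRsups M \<Lambda> = {X \<in> FR \<Lambda>. M \<subseteq> X \<and> \<not> (\<exists>Y \<in> FR \<Lambda>. M \<subseteq> Y \<and> Y \<subset> X)}"

definition reception_compatible :: "('f, 'm) satisfaction_system \<Rightarrow> bool" where
  "reception_compatible \<Lambda> \<longleftrightarrow>
     (\<forall>B \<in> Fpow (formulae \<Lambda>). \<forall>M \<in> Pow (models \<Lambda>). FRsups (Mod \<Lambda> B \<union> M) \<Lambda> \<noteq> {})"

definition model_change_operation ::
    "('f, 'm) satisfaction_system \<Rightarrow> ('f set \<times> 'm set \<Rightarrow> 'f set) \<Rightarrow> bool" where
  "model_change_operation \<Lambda> chg \<longleftrightarrow>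
     chg \<in> Fpow (formulae \<Lambda>) \<times> Pow (models \<Lambda>) \<rightarrow> Fpow (formulae \<Lambda>)"

text \<open>\<open>\<gamma>\<close> is constrained only on its intended domain, the nonempty subsets of \<open>FR \<Lambda>\<close>;
  its values there lie in \<open>FR \<Lambda>\<close> because \<open>\<gamma> \<X> \<in> \<X> \<subseteq> FR \<Lambda>\<close>.\<close>

definition selection_function ::
    "('f, 'm) satisfaction_system \<Rightarrow> ('m set set \<Rightarrow> 'm set) \<Rightarrow> bool" where
  "selection_function \<Lambda> \<gamma> \<longleftrightarrow> (\<forall>\<X>. \<X> \<subseteq> FR \<Lambda> \<and> \<X> \<noteq> {} \<longrightarrow> \<gamma> \<X> \<in> \<X>)"

definition maxichoice_reception ::
    "('f, 'm) satisfaction_system \<Rightarrow> ('f set \<times> 'm set \<Rightarrow> 'f set) \<Rightarrow> bool" where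
  "maxichoice_reception \<Lambda> chg \<longleftrightarrow>
     (\<exists>\<gamma>. selection_function \<Lambda> \<gamma> \<and>
        (\<forall>B \<in> Fpow (formulae \<Lambda>). \<forall>M \<in> Pow (models \<Lambda>).
           Mod \<Lambda> (chg (B, M)) = \<gamma> (FRsups (Mod \<Lambda> B \<union> M) \<Lambda>)))"

definition success ::
    "('f, 'm) satisfaction_system \<Rightarrow> ('f set \<times> 'm set \<Rightarrow> 'f set) \<Rightarrow> bool" where
  "success \<Lambda> chg \<longleftrightarrow>
     (\<forall>B \<in> Fpow (formulae \<Lambda>). \<forall>M \<in> Pow (models \<Lambda>). M \<subseteq> Mod \<Lambda> (chg (B, M)))"

definition persistence ::
    "('f, 'm) satisfaction_system \<Rightarrow> ('f set \<times> 'm set \<Rightarrow> 'f set) \<Rightarrow> bool" where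
  "persistence \<Lambda> chg \<longleftrightarrow>
     (\<forall>B \<in> Fpow (formulae \<Lambda>). \<forall>M \<in> Pow (models \<Lambda>). Mod \<Lambda> B \<subseteq> Mod \<Lambda> (chg (B, M)))"

definition vacuity ::
    "('f, 'm) satisfaction_system \<Rightarrow> ('f set \<times> 'm set \<Rightarrow> 'f set) \<Rightarrow> bool" where
  "vacuity \<Lambda> chg \<longleftrightarrow>
     (\<forall>B \<in> Fpow (formulae \<Lambda>). \<forall>M \<in> Pow (models \<Lambda>).
        M \<subseteq> Mod \<Lambda> B \<longrightarrow> Mod \<Lambda> (chg (B, M)) = Mod \<Lambda> B)"

definition finite_temperance ::
    "('f, 'm) satisfaction_system \<Rightarrow> ('f set \<times> 'm set \<Rightarrow> 'f set) \<Rightarrow> bool" where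
  "finite_temperance \<Lambda> chg \<longleftrightarrow>
     (\<forall>B \<in> Fpow (formulae \<Lambda>). \<forall>M \<in> Pow (models \<Lambda>). \<forall>M''.
        Mod \<Lambda> B \<union> M \<subseteq> M'' \<and> M'' \<subset> Mod \<Lambda> (chg (B, M)) \<longrightarrow> M'' \<notin> FR \<Lambda>)"

definition uniformity ::
    "('f, 'm) satisfaction_system \<Rightarrow> ('f set \<times> 'm set \<Rightarrow> 'f set) \<Rightarrow> bool" where
  "uniformity \<Lambda> chg \<longleftrightarrow>
     (\<forall>B \<in> Fpow (formulae \<Lambda>). \<forall>B' \<in> Fpow (formulae \<Lambda>).
      \<forall>M \<in> Pow (models \<Lambda>). \<forall>M' \<in> Pow (models \<Lambda>).
        FRsups (Mod \<Lambda> B \<union> M) \<Lambda> = FRsups (Mod \<Lambda> B' \<union> M') \<Lambda> \<longrightarrow>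
        Mod \<Lambda> (chg (B, M)) = Mod \<Lambda> (chg (B', M')))"

end

theory Submission
  imports Defs
begin

text \<open>
  Success, persistence and finite temperance together say exactly that the outcome of a change
  is a minimal finitely representable superset of \<open>Mod \<Lambda> B \<union> M\<close>; uniformity says that the outcome
  depends only on the set of these supersets, and so is a function of it. Vacuity is then automatic,
  since a finitely representable set is its own only minimal finitely representable superset.
\<close>

lemma FRsups_subset_FR: "FRsups M \<Lambda> \<subseteq> FR \<Lambda>"
  by (auto simp: FRsups_def)

lemma Mod_in_FR: "B \<in> Fpow (formulae \<Lambda>) \<Longrightarrow> Mod \<Lambda> B \<in> FR \<Lambda>"
  by (auto simp: FR_def Mod_def)

text \<open>\<open>X\<close> is itself a candidate, and every other candidate properly contains it
  and so fails minimality.\<close>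

lemma FRsups_of_FR: "X \<in> FR \<Lambda> \<Longrightarrow> FRsups X \<Lambda> = {X}"
  by (auto simp: FRsups_def)

lemma model_change_operation_Mod_in_FR:
  assumes "model_change_operation \<Lambda> chg" "B \<in> Fpow (formulae \<Lambda>)" "M \<in> Pow (models \<Lambda>)"
  shows "Mod \<Lambda> (chg (B, M)) \<in> FR \<Lambda>"
  using assms by (auto simp: model_change_operation_def intro: Mod_in_FR)

text \<open>The equivalence holds pair by pair: since \<open>chg\<close> returns a finite base, its
  outcome is in \<open>FR \<Lambda>\<close>, and what remains of \<open>FRsups\<close> is inclusion
  of \<open>M\<close>, inclusion of \<open>Mod \<Lambda> B\<close>, and minimality.\<close>

lemma Mod_chg_in_FRsups_iff:
  assumes "model_change_operation \<Lambda> chg"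
  shows "(\<forall>B \<in> Fpow (formulae \<Lambda>). \<forall>M \<in> Pow (models \<Lambda>).
            Mod \<Lambda> (chg (B, M)) \<in> FRsups (Mod \<Lambda> B \<union> M) \<Lambda>) \<longleftrightarrow>
         success \<Lambda> chg \<and> persistence \<Lambda> chg \<and> finite_temperance \<Lambda> chg"
proof -
  have "Mod \<Lambda> (chg (B, M)) \<in> FRsups (Mod \<Lambda> B \<union> M) \<Lambda> \<longleftrightarrow>
      M \<subseteq> Mod \<Lambda> (chg (B, M)) \<and> Mod \<Lambda> B \<subseteq> Mod \<Lambda> (chg (B, M)) \<and>
      (\<forall>M''. Mod \<Lambda> B \<union> M \<subseteq> M'' \<and> M'' \<subset> Mod \<Lambda> (chg (B, M)) \<longrightarrow> M'' \<notin> FR \<Lambda>)"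
    if "B \<in> Fpow (formulae \<Lambda>)" "M \<in> Pow (models \<Lambda>)" for B M
    using model_change_operation_Mod_in_FR[OF assms that] by (auto simp: FRsups_def)
  then show ?thesis
    unfolding success_def persistence_def finite_temperance_def by (simp add: ball_conj_distrib)
qed

lemma vacuity_if_Mod_chg_in_FRsups:
  assumes "\<forall>B \<in> Fpow (formulae \<Lambda>). \<forall>M \<in> Pow (models \<Lambda>).
             Mod \<Lambda> (chg (B, M)) \<in> FRsups (Mod \<Lambda> B \<union> M) \<Lambda>"
  shows "vacuity \<Lambda> chg"
  unfolding vacuity_def
proof (intro ballI impI)
  fix B M
  assume B: "B \<in> Fpow (formulae \<Lambda>)" and M: "M \<in> Pow (models \<Lambda>)" and "M \<subseteq> Mod \<Lambda> B"
  then have "Mod \<Lambda> B \<union> M = Mod \<Lambda> B" by blast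
  with bspec[OF bspec[OF assms B] M] FRsups_of_FR[OF Mod_in_FR[OF B]] show "Mod \<Lambda> (chg (B, M)) = Mod \<Lambda> B"
    by simp
qed

text \<open>Forwards, reception-compatibility makes each \<open>FRsups\<close> family nonempty, so
  \<gamma> must pick a member of it; uniformity is just \<gamma> being a function. Backwards,
  \<gamma> is read off from the values of \<open>chg\<close>.\<close>

lemma maxichoice_reception_iff:
  assumes "reception_compatible \<Lambda>"
  shows "maxichoice_reception \<Lambda> chg \<longleftrightarrow>
    (\<forall>B \<in> Fpow (formulae \<Lambda>). \<forall>M \<in> Pow (models \<Lambda>).
       Mod \<Lambda> (chg (B, M)) \<in> FRsups (Mod \<Lambda> B \<union> M) \<Lambda>) \<and> uniformity \<Lambda> chg"
    (is "_ \<longleftrightarrow> ?minimal \<and> _")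
proof
  assume "maxichoice_reception \<Lambda> chg"
  then obtain \<gamma> where sel: "selection_function \<Lambda> \<gamma>"
    and chg: "\<And>B M. B \<in> Fpow (formulae \<Lambda>) \<Longrightarrow> M \<in> Pow (models \<Lambda>) \<Longrightarrow>
      Mod \<Lambda> (chg (B, M)) = \<gamma> (FRsups (Mod \<Lambda> B \<union> M) \<Lambda>)"
    unfolding maxichoice_reception_def by blast
  have ?minimal
  proof (intro ballI)
    fix B M assume BM: "B \<in> Fpow (formulae \<Lambda>)" "M \<in> Pow (models \<Lambda>)"
    then have "FRsups (Mod \<Lambda> B \<union> M) \<Lambda> \<noteq> {}"
      using assms by (simp add: reception_compatible_def)
    then show "Mod \<Lambda> (chg (B, M)) \<in> FRsups (Mod \<Lambda> B \<union> M) \<Lambda>"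
      using sel FRsups_subset_FR unfolding chg[OF BM] selection_function_def by blast
  qed
  moreover have "uniformity \<Lambda> chg"
    by (simp add: uniformity_def chg)
  ultimately show "?minimal \<and> uniformity \<Lambda> chg" ..
next
  assume asm: "?minimal \<and> uniformity \<Lambda> chg"
  \<comment> \<open>The graph of the required \<gamma>, stated as a relation because different pairs
    \<open>(B, M)\<close> may yield the same family.\<close>
  define outcome where "outcome \<X> Y \<longleftrightarrow>
    (\<exists>B \<in> Fpow (formulae \<Lambda>). \<exists>M \<in> Pow (models \<Lambda>).
       \<X> = FRsups (Mod \<Lambda> B \<union> M) \<Lambda> \<and> Y = Mod \<Lambda> (chg (B, M)))" for \<X> Y
  \<comment> \<open>A selection function must also choose from nonempty families that arise from no
    pair \<open>(B, M)\<close>; there any member will do.\<close>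
  define \<gamma> where "\<gamma> \<X> = (if \<exists>Y. outcome \<X> Y then THE Y. outcome \<X> Y else SOME Y. Y \<in> \<X>)" for \<X>
  \<comment> \<open>Uniformity is exactly the single-valuedness of \<open>outcome\<close>.\<close>
  have outcome_unique: "Y = Z" if "outcome \<X> Y" "outcome \<X> Z" for \<X> Y Z
    using that asm unfolding outcome_def uniformity_def by blast
  have \<gamma>_outcome: "\<gamma> \<X> = Y" if "outcome \<X> Y" for \<X> Y
  proof -
    have "(THE Y. outcome \<X> Y) = Y"
      using that by (rule the_equality) (rule outcome_unique[OF _ that])
    with that show ?thesis by (metis \<gamma>_def)
  qed
  have "selection_function \<Lambda> \<gamma>"
    unfolding selection_function_def
  proof (intro allI impI)
    fix \<X> assume \<X>: "\<X> \<subseteq> FR \<Lambda> \<and> \<X> \<noteq> {}"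
    show "\<gamma> \<X> \<in> \<X>"
    proof (cases "\<exists>Y. outcome \<X> Y")
      case True
      then obtain Y where Y: "outcome \<X> Y" ..
      \<comment> \<open>By \<open>?minimal\<close>, a prescribed value lies in the family that it is
        prescribed for.\<close>
      then have "Y \<in> \<X>" using asm unfolding outcome_def by blast
      then show ?thesis using \<gamma>_outcome[OF Y] by simp
    next
      case False
      then show ?thesis using \<X> by (simp add: \<gamma>_def some_in_eq)
    qed
  qed
  moreover have "Mod \<Lambda> (chg (B, M)) = \<gamma> (FRsups (Mod \<Lambda> B \<union> M) \<Lambda>)"
    if "B \<in> Fpow (formulae \<Lambda>)" "M \<in> Pow (models \<Lambda>)" for B M
    by (rule \<gamma>_outcome[symmetric]) (use that in \<open>auto simp: outcome_def\<close>)
  ultimately show "maxichoice_reception \<Lambda> chg"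
    unfolding maxichoice_reception_def by blast
qed

theorem theorem2:
  fixes \<Lambda> :: "('f, 'm) satisfaction_system"
    and chg :: "'f set \<times> 'm set \<Rightarrow> 'f set"
  assumes "reception_compatible \<Lambda>"
    and "model_change_operation \<Lambda> chg"
  shows "maxichoice_reception \<Lambda> chg \<longleftrightarrow>
    success \<Lambda> chg \<and> persistence \<Lambda> chg \<and> vacuity \<Lambda> chg \<and>
    finite_temperance \<Lambda> chg \<and> uniformity \<Lambda> chg"
  unfolding maxichoice_reception_iff[OF assms(1)]
  \<comment> \<open>Propositional from here: minimality of the outcomes amounts to three of the
    postulates and implies vacuity.\<close>
  using Mod_chg_in_FRsups_iff[OF assms(2)] vacuity_if_Mod_chg_in_FRsups[of \<Lambda> chg] by argo

end
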